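(* Let $q\in\mathbb{Z}_{\ge 3}$ and let $\zeta,\lambda$, $\mathrm{UR}_{2q}$ and $\Delta^{(1)}_q\subset\mathbb{C}$ be as defined in the context. (a) The set $\Delta^{(1)}_q$ is an infinite discrete subset of $\mathbb{C}$. (b) It is invariant under rotation (around $0$) by $\frac{2\pi}{2q}$. (c) It contains the set $\mathrm{UR}_{2q}$ of $2q$-th unit roots. It contains the $4q$ elements $\mathrm{UR}_{2q}\cdot\{\lambda+\zeta,\,1+\lambda\zeta\}$. (d) Any element of $\Delta^{(1)}_q\setminus\bigl(\mathrm{UR}_{2q}\cdot\{1,\lambda+\zeta,1+\lambda\zeta\}\bigr)$ has absolute value bigger than $|\lambda+\zeta|=|1+\lambda\zeta|=\sqrt{2\lambda^2+1}$. Here $\sqrt{2\lambda^2+1}$ equals $\sqrt{3}$ for $q=3$, $\sqrt{5}$ for $q=4$, $\sqrt{4+\sqrt{5}}$ for $q=5$, $\sqrt{7}$ for $q=6$, and it lies in the open interval $(2.7375,\,3)$ for $q\ge 7$.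
   Context: For $q\in\mathbb{Z}_{\ge 3}$ put $\zeta:=e^{2\pi i/(2q)}\in\mathbb{C}$ and $\lambda:=\zeta+\overline{\zeta}=2\cos\frac{\pi}{q}\in[1,2)$. Put $\mathrm{UR}_{2q}:=\{\zeta^k\mid k\in\{0,1,\dots,2q-1\}\}$. Let $$V:=\begin{pmatrix}0&-1\\1&0\end{pmatrix},\qquad A_1:=\begin{pmatrix}1&\lambda\\0&1\end{pmatrix},\qquad G_q^{mat}:=\langle V,A_1\rangle\subset SL_2(\mathbb{Z}[\lambda])\subset SL_2(\mathbb{R}).$$ Let $\psi:M_{2\times1}(\mathbb{R})\to\mathbb{C}$ be the isomorphism of two-dimensional $\mathbb{R}$-vector spaces $\psi\begin{pmatrix}x_1\\ x_2\end{pmatrix}=x_1+\zeta^{q-1}x_2$. Define $$\Delta^{(1)}_q:=\psi\Bigl(G_q^{mat}\cdot\begin{pmatrix}1\\0\end{pmatrix}\Bigr)\subset\mathbb{C}.$$ For subsets $X,Y\subset\mathbb{C}$, $X\cdot Y:=\{xy\mid x\in X,y\in Y\}$.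
   Formalization: The count of 4q elements in (c) is claimed only for q ≥ 4: for q = 3 one has λ = 1, so λ+ζ = 1+λζ and the set has 6 elements rather than 12; the containment itself is stated for all q ≥ 3. *)

theory Defs
  imports "HOL-Analysis.Analysis" "HOL-Algebra.Generated_Groups" "HOL-Library.Set_Algebras"
begin

definition zeta :: "nat \<Rightarrow> complex" where
  "zeta q = exp (2 * of_real pi * \<i> / (2 * of_nat q))"

definition lam :: "nat \<Rightarrow> real" where
  "lam q = 2 * cos (pi / real q)"

lemma of_real_lam: "complex_of_real (lam q) = zeta q + cnj (zeta q)"
proof -
  have "zeta q = cis (pi / real q)"
    by (simp add: zeta_def cis_conv_exp mult_ac)
  then show ?thesis
    by (simp add: lam_def complex_eq_iff)
qed

definition UR :: "nat \<Rightarrow> complex set" where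
  "UR q = {zeta q ^ k | k. k \<in> {0..2 * q - 1}}"

definition SL2R :: "(real^2^2) monoid" where
  "SL2R = \<lparr>carrier = {A. det A = 1}, monoid.mult = (\<lambda>A B. A ** B), one = mat 1\<rparr>"

lemma group_SL2R: "group SL2R"
proof (rule groupI)
  fix A assume "A \<in> carrier SL2R"
  then have "det A = 1" by (simp add: SL2R_def)
  then obtain B where B: "B ** A = mat 1"
    by (metis invertible_det_nz invertible_def zero_neq_one)
  with \<open>det A = 1\<close> have "det B = 1"
    by (metis det_I det_mul mult.right_neutral)
  with B show "\<exists>B\<in>carrier SL2R. B \<otimes>\<^bsub>SL2R\<^esub> A = \<one>\<^bsub>SL2R\<^esub>"
    by (auto simp: SL2R_def)
qed (auto simp: SL2R_def det_mul matrix_mul_assoc)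

text \<open>Matrices are given by their rows.\<close>

definition matV :: "real^2^2" where
  "matV = vector [vector [0, -1], vector [1, 0]]"

definition matA1 :: "nat \<Rightarrow> real^2^2" where
  "matA1 q = vector [vector [1, lam q], vector [0, 1]]"

definition Gmat :: "nat \<Rightarrow> (real^2^2) set" where
  "Gmat q = generate SL2R {matV, matA1 q}"

lemma generators_in_SL2R: "{matV, matA1 q} \<subseteq> carrier SL2R"
  by (simp add: SL2R_def matV_def matA1_def det_2)

definition psi :: "nat \<Rightarrow> real^2 \<Rightarrow> complex" where
  "psi q x = of_real (x $ 1) + zeta q ^ (q - 1) * of_real (x $ 2)"

definition Delta1 :: "nat \<Rightarrow> complex set" where
  "Delta1 q = psi q ` ((\<lambda>g. g *v vector [1, 0]) ` Gmat q)"

end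

theory Submission
  imports Defs
begin

text \<open>
  Write \<open>A\<close> for \<open>A\<^sub>1\<close> and identify \<open>\<real>\<^sup>2\<close> with the complex plane by \<open>\<psi>\<close>. Then \<open>A V\<close> is the rotation by
  \<open>\<zeta>\<close>, and \<open>A\<close> is a shear that maps the image of the first quadrant, the sector from \<open>1\<close> to
  \<open>\<zeta>\<close> to the power \<open>q - 1\<close>, onto the sector from \<open>1\<close> to \<open>\<zeta>\<close>. The \<open>q - 1\<close> rotated shears
  therefore subdivide the first quadrant, as the two Farey maps do for \<open>q = 3\<close>. The vectors obtained
  from the two standard unit vectors by this subdivision, together with their images under \<open>-1\<close>,
  \<open>V\<close> and \<open>-V\<close>, form a set closed under the group, hence contain the whole orbit. Their coordinates
  are nonnegative and grow under the subdivision, so that the shortest orbit vectors are found in its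
  first two generations. Since the coordinates are also \<open>0\<close> or at least \<open>1\<close> in absolute value, the
  determinant of two nonproportional orbit vectors is at least \<open>1\<close> in absolute value, which gives
  discreteness.
\<close>

text \<open>The length of the \<open>j\<close>-th diagonal of a regular \<open>q\<close>-gon with side \<open>1\<close>.\<close>

definition diag :: "nat \<Rightarrow> nat \<Rightarrow> real" where
  "diag q j = sin (real j * pi / real q) / sin (pi / real q)"

text \<open>
  A step passes from \<open>(a, b)\<close> to the coordinates, with respect to \<open>1\<close> and \<open>\<zeta> ^ (q - 1)\<close>, of
  \<open>a * \<zeta> ^ j + b * \<zeta> ^ (j + 1)\<close>.
\<close>

inductive farey :: "nat \<Rightarrow> real \<Rightarrow> real \<Rightarrow> bool" for q where
  fst: "farey q 1 0"
| snd: "farey q 0 1"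
| step: "farey q a b \<Longrightarrow> j + 2 \<le> q \<Longrightarrow>
    farey q (a * diag q (Suc j) + b * diag q (Suc (Suc j))) (a * diag q j + b * diag q (Suc j))"

text \<open>The Farey vectors and their images under \<open>-1\<close>, \<open>V\<close> and \<open>-V\<close>.\<close>

definition quadrants :: "nat \<Rightarrow> real \<Rightarrow> real \<Rightarrow> bool" where
  "quadrants q x y \<longleftrightarrow> farey q x y \<or> farey q (- x) (- y) \<or> farey q y (- x) \<or> farey q (- y) x"

section \<open>Powers of \<zeta> and lengths of diagonals\<close>

lemma zeta_eq_cis: "zeta q = cis (pi / real q)"
  by (simp add: zeta_def cis_conv_exp mult_ac)

lemma zeta_power: "zeta q ^ k = cis (real k * pi / real q)"
  by (simp only: zeta_eq_cis Complex.DeMoivre times_divide_eq_right)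

lemma diag_0 [simp]: "diag q 0 = 0"
  by (simp add: diag_def)

text \<open>The addition formulas give \<open>sin (u + t) + sin (u - t) = 2 * cos t * sin u\<close>.
  The index is unrestricted; the value at \<open>q + 1\<close>, where \<open>diag\<close> is
  negative, is used once.\<close>

lemma diag_rec: "diag q (Suc (Suc j)) = lam q * diag q (Suc j) - diag q j"
proof -
  let ?t = "pi / real q" and ?u = "real (Suc j) * pi / real q"
  have "real (Suc (Suc j)) * pi / real q = ?u + ?t" "real j * pi / real q = ?u - ?t"
    by (simp_all add: field_simps add_divide_distrib)
  then have "sin (real (Suc (Suc j)) * pi / real q) + sin (real j * pi / real q) = lam q * sin ?u"
    by (simp only: sin_add sin_diff lam_def) simp
  then show ?thesis
    by (simp add: diag_def add_divide_distrib [symmetric] eq_diff_eq)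
qed

locale hecke =
  fixes q :: nat
  assumes q: "3 \<le> q"
begin

lemma sin_pos: "0 < sin (pi / real q)"
  using q by (intro sin_gt_zero) (auto simp: field_simps)

lemma lam_ge_1: "1 \<le> lam q"
proof -
  have "cos (pi / 3) \<le> cos (pi / real q)"
    using q by (intro cos_monotone_0_pi_le) (auto simp: field_simps)
  then show ?thesis by (simp add: lam_def cos_60)
qed

lemma lam_gt_1:
  assumes "4 \<le> q"
  shows "1 < lam q"
proof -
  have "cos (pi / 3) < cos (pi / real q)"
    using assms by (intro cos_monotone_0_pi) (auto simp: field_simps)
  then show ?thesis by (simp add: lam_def cos_60)
qed

lemma diag_1 [simp]: "diag q (Suc 0) = 1"
  using sin_pos by (simp add: diag_def)

lemma diag_2 [simp]: "diag q (Suc (Suc 0)) = lam q"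
  by (simp add: diag_rec)

lemma diag_sym:
  assumes "j \<le> q"
  shows "diag q (q - j) = diag q j"
proof -
  have "real (q - j) * pi / real q = pi - real j * pi / real q"
    using q assms by (simp add: of_nat_diff field_simps)
  then show ?thesis by (simp add: diag_def)
qed

text \<open>Sine increases up to \<open>pi / 2\<close>; an index \<open>j\<close> beyond the middle
  is first reflected to \<open>q - j\<close>, and \<open>i + j \<le> q\<close> says that
  \<open>i\<close> does not exceed this reflection.\<close>

lemma diag_mono:
  assumes "i \<le> j" "i + j \<le> q"
  shows "diag q i \<le> diag q j"
proof -
  have mono: "diag q i \<le> diag q k" if "i \<le> k" "2 * k \<le> q" for k
  proof -
    have "real (2 * k) \<le> real q" using that by (simp only: of_nat_le_iff)
    then have "real k * pi / real q \<le> pi / 2"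
      using q by (simp add: field_simps)
    moreover have "real i * pi / real q \<le> real k * pi / real q"
      using that by (intro divide_right_mono mult_right_mono) auto
    moreover have "0 \<le> real i * pi / real q" by simp
    ultimately have "sin (real i * pi / real q) \<le> sin (real k * pi / real q)"
      using pi_gt_zero by (intro sin_monotone_2pi_le) linarith+
    then show ?thesis
      using sin_pos by (simp add: diag_def divide_right_mono)
  qed
  show ?thesis
  proof (cases "2 * j \<le> q")
    case True
    then show ?thesis using mono assms by simp
  next
    case False
    then have "diag q i \<le> diag q (q - j)" using assms by (intro mono) auto
    also have "\<dots> = diag q j" using assms by (intro diag_sym) auto
    finally show ?thesis .
  qed
qed

lemma diag_ge_1: "1 \<le> j \<Longrightarrow> j < q \<Longrightarrow> 1 \<le> diag q j"
  using diag_mono[of 1 j] by simp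

lemma diag_ge_lam: "2 \<le> j \<Longrightarrow> j + 2 \<le> q \<Longrightarrow> lam q \<le> diag q j"
  using diag_mono[of 2 j] by (simp add: numeral_2_eq_2)

lemma diag_nonneg: "j \<le> q \<Longrightarrow> 0 \<le> diag q j"
  using diag_mono[of 0 j] by simp

lemma diag_q: "diag q q = 0" "diag q (q - Suc 0) = 1" "diag q (q - 2) = lam q"
  using diag_sym[of 0] diag_sym[of 1] diag_sym[of 2] q by (simp_all add: numeral_2_eq_2)

lemma zeta_power_q: "zeta q ^ q = - 1"
  using q by (simp add: zeta_power)

lemma zeta_power_2q: "zeta q ^ (2 * q) = 1"
  by (simp add: mult.commute[of 2] power_mult zeta_power_q)

text \<open>Both sides equal \<open>- 1 / zeta q\<close>, because
  \<open>zeta q * cnj (zeta q) = 1\<close>.\<close>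

lemma zeta_power_pred: "zeta q ^ (q - Suc 0) = zeta q - of_real (lam q)"
proof -
  have "zeta q * zeta q ^ (q - Suc 0) = - 1"
    using q by (simp add: zeta_power_q flip: power_Suc)
  moreover have "zeta q * (zeta q - of_real (lam q)) = - 1"
    by (simp add: of_real_lam zeta_eq_cis cis_cnj cis_mult)
  moreover have "zeta q \<noteq> 0" by (simp add: zeta_def)
  ultimately show ?thesis by (metis mult_left_cancel)
qed

lemma zeta_sq: "zeta q * zeta q = of_real (lam q) * zeta q - 1"
  by (simp add: of_real_lam zeta_eq_cis cis_cnj cis_mult algebra_simps)

text \<open>Both sides obey the recursion given by \<open>zeta_sq\<close>. For \<open>j < q\<close>
  these coordinates are the first generation of Farey vectors.\<close>

lemma zeta_power_diag:
  "zeta q ^ j = of_real (diag q (Suc j)) + zeta q ^ (q - 1) * of_real (diag q j)"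
proof (induction j)
  case 0
  then show ?case by simp
next
  case (Suc j)
  let ?l = "complex_of_real (lam q)" and ?c = "complex_of_real (diag q j)"
    and ?d = "complex_of_real (diag q (Suc j))"
  have "zeta q ^ Suc j = ?d * zeta q + ?c * (zeta q * zeta q - ?l * zeta q)"
    by (simp add: Suc.IH zeta_power_pred algebra_simps)
  also have "\<dots> = (?l * ?d - ?c) + (zeta q - ?l) * ?d"
    by (simp add: zeta_sq algebra_simps)
  finally show ?case
    by (simp add: diag_rec zeta_power_pred)
qed

lemma psi_vector: "psi q (vector [x, y]) = of_real x + zeta q ^ (q - 1) * of_real y"
  by (simp add: psi_def)

section \<open>Coordinates of the Farey vectors\<close>

lemma farey_diag:
  assumes "j < q"
  shows "farey q (diag q (Suc j)) (diag q j)"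
proof (cases "j + 2 \<le> q")
  case True
  then show ?thesis using farey.step[OF farey.fst, of j] by simp
next
  case False
  then have "j = q - 1" using assms by simp
  then show ?thesis using q farey.snd diag_q by simp
qed

text \<open>The coordinates are at least those obtained from \<open>a = b = 1\<close>, which are
  sums of two neighbouring diagonals. The alternative is needed: this estimate gives only
  \<open>1 \<le> d\<close> for \<open>j = 0\<close> and only \<open>1 \<le> c\<close> for
  \<open>j = q - 2\<close>.\<close>

lemma farey_step_interior:
  assumes "1 \<le> a" "1 \<le> b" "j + 2 \<le> q"
  defines "c \<equiv> a * diag q (Suc j) + b * diag q (Suc (Suc j))"
    and "d \<equiv> a * diag q j + b * diag q (Suc j)"
  shows "(lam q + 1 \<le> c \<and> 1 \<le> d) \<or> (1 \<le> c \<and> lam q + 1 \<le> d)"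
proof -
  have nonneg: "0 \<le> diag q j" "0 \<le> diag q (Suc j)" "0 \<le> diag q (Suc (Suc j))"
    using assms by (auto intro!: diag_nonneg)
  have c: "diag q (Suc j) + diag q (Suc (Suc j)) \<le> c"
    unfolding c_def using assms(1,2) nonneg by (intro add_mono) (simp_all add: mult_le_cancel_right1)
  have d: "diag q j + diag q (Suc j) \<le> d"
    unfolding d_def using assms(1,2) nonneg by (intro add_mono) (simp_all add: mult_le_cancel_right1)
  have "1 \<le> diag q (Suc j)" using assms(3) by (intro diag_ge_1) auto
  show ?thesis
  proof (cases "j + 3 \<le> q")
    case True
    have "lam q + 1 \<le> diag q (Suc j) + diag q (Suc (Suc j))"
    proof (cases "j = 0")
      case False
      then have "lam q \<le> diag q (Suc j)" "1 \<le> diag q (Suc (Suc j))"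
        using True by (auto intro!: diag_ge_lam diag_ge_1)
      then show ?thesis by simp
    qed simp
    then show ?thesis using c d nonneg \<open>1 \<le> diag q (Suc j)\<close> by linarith
  next
    case False
    then have "j = q - 2" "Suc j = q - 1" using assms(3) by auto
    then have "diag q j = lam q" "diag q (Suc j) = 1"
      using diag_q by (metis, metis One_nat_def)
    then show ?thesis using c d nonneg by linarith
  qed
qed

text \<open>A step takes the two axis vectors to consecutive diagonals; all other pairs of
  consecutive diagonals have both entries at least \<open>1\<close>, so that
  \<open>farey_step_interior\<close> applies from then on.\<close>

lemma farey_cases:
  assumes "farey q a b"
  shows "(\<exists>j<q. a = diag q (Suc j) \<and> b = diag q j) \<or>
    (lam q + 1 \<le> a \<and> 1 \<le> b) \<or> (1 \<le> a \<and> lam q + 1 \<le> b)"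
  using assms
proof (induction rule: farey.induct)
  case fst
  then show ?case using q by (intro disjI1 exI[of _ 0]) simp
next
  case snd
  then show ?case using q by (intro disjI1 exI[of _ "q - 1"]) (simp add: diag_q)
next
  case (step a b j)
  have interior: ?case if "1 \<le> a" "1 \<le> b"
    using farey_step_interior[OF that \<open>j + 2 \<le> q\<close>] by blast
  from step.IH show ?case
  proof (elim disjE exE conjE)
    fix k assume k: "k < q" "a = diag q (Suc k)" "b = diag q k"
    consider "k = 0" | "k = q - 1" | "1 \<le> k" "k < q - 1" using k by linarith
    then show ?case
    proof cases
      case 1
      then show ?thesis using k step.hyps by (intro disjI1 exI[of _ j]) simp
    next
      case 2
      \<comment> \<open>The step sends \<open>(0, 1)\<close> to \<open>\<zeta> ^ (j + 1)\<close>,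
        hence the shifted index.\<close>
      then show ?thesis using k step.hyps q by (intro disjI1 exI[of _ "Suc j"]) (simp add: diag_q)
    next
      case 3
      then show ?thesis using k by (intro interior) (auto intro!: diag_ge_1)
    qed
  qed (use interior lam_ge_1 in auto)
qed

text \<open>Only the outermost pairs of consecutive diagonals, \<open>k = 0\<close> and
  \<open>k = q - 1\<close>, contain a zero. Discreteness rests on this gap between \<open>0\<close>
  and \<open>1\<close>.\<close>

lemma farey_coords:
  assumes "farey q a b"
  shows "(a = 1 \<and> b = 0) \<or> (a = 0 \<and> b = 1) \<or> (1 \<le> a \<and> 1 \<le> b)"
  using farey_cases[OF assms]
proof (elim disjE exE conjE)
  fix k assume k: "k < q" "a = diag q (Suc k)" "b = diag q k"
  consider "k = 0" | "k = q - 1" | "1 \<le> k" "k < q - 1" using k by linarith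
  then show ?thesis
    using k q by cases (auto simp: diag_q intro!: diag_ge_1)
qed (use lam_ge_1 in auto)

text \<open>The step with \<open>j = 0\<close> is the action of \<open>matA1 q\<close>; the one with
  \<open>j = q - 2\<close>, treated next, is its inverse conjugated by \<open>matV\<close>.\<close>

lemma farey_shear_fst: "farey q a b \<Longrightarrow> farey q (a + b * lam q) b"
  using farey.step[of q a b 0] q by simp

lemma farey_shear_snd: "farey q a b \<Longrightarrow> farey q a (a * lam q + b)"
proof -
  assume "farey q a b"
  moreover have "Suc (q - 2) = q - 1" "Suc (q - 1) = q" using q by auto
  ultimately show ?thesis using farey.step[of q a b "q - 2"] q by (simp add: diag_q)
qed

section \<open>Rotation, shear and inverse shear on the four quadrants\<close>

lemma quadrants_minus: "quadrants q (- x) (- y) \<longleftrightarrow> quadrants q x y"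
  by (auto simp: quadrants_def)

lemma quadrants_V: "quadrants q (- y) x \<longleftrightarrow> quadrants q x y"
  by (auto simp: quadrants_def)

text \<open>In the coordinates of \<open>psi\<close> this is multiplication by \<zeta>. It turns the
  step with index \<open>j\<close> into the one with index \<open>j + 1\<close>; from the last index
  it leads to the image of the parent \<open>(a', b')\<close> under \<open>matV\<close>.\<close>

lemma quadrants_farey_rotate:
  assumes "farey q a b"
  shows "quadrants q (a * lam q - b) a"
  using assms
proof cases
  case fst
  then show ?thesis using farey_diag[of 1] q by (simp add: quadrants_def)
next
  case snd
  then show ?thesis using farey.fst by (simp add: quadrants_def)
next
  case (step a' b' j)
  have eq: "a * lam q - b = a' * diag q (Suc (Suc j)) + b' * diag q (Suc (Suc (Suc j)))"
    by (simp add: step diag_rec algebra_simps)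
  show ?thesis
  proof (cases "Suc j + 2 \<le> q")
    case True
    with step eq show ?thesis
      using farey.step[of q a' b' "Suc j"] by (simp add: quadrants_def)
  next
    case False
    then have j: "q - Suc 0 = Suc j" "q = Suc (Suc j)" using step by auto
    then have "diag q (Suc j) = 1" "diag q (Suc (Suc j)) = 0"
      using diag_q by metis+
    \<comment> \<open>This index is \<open>q + 1\<close>, just past the polygon.\<close>
    moreover from this have "diag q (Suc (Suc (Suc j))) = - 1"
      by (simp add: diag_rec[of q "Suc j"])
    ultimately have "a * lam q - b = - b'" "a = a'" using eq step by simp_all
    then show ?thesis using step by (simp add: quadrants_def)
  qed
qed

text \<open>Index \<open>0\<close> gives back the parent; index \<open>Suc i\<close> gives the image
  under \<open>matV\<close> of the step with index \<open>i\<close> from the same parent.\<close>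

lemma quadrants_farey_unshear:
  assumes "farey q a b"
  shows "quadrants q (a - b * lam q) b"
  using assms
proof cases
  case fst
  then show ?thesis using farey.fst by (simp add: quadrants_def)
next
  case snd
  then show ?thesis using farey_shear_snd[OF farey.fst] by (simp add: quadrants_def)
next
  case (step a' b' j)
  show ?thesis
  proof (cases j)
    case 0
    with step show ?thesis by (simp add: quadrants_def)
  next
    case (Suc i)
    have "b * lam q - a = a' * diag q i + b' * diag q (Suc i)"
      by (simp add: step diag_rec Suc algebra_simps)
    then show ?thesis
      using step Suc farey.step[of q a' b' i] by (simp add: quadrants_def)
  qed
qed

text \<open>On the first quadrant and its negative the shear is the step with \<open>j = 0\<close>.
  The other two quadrants are, up to sign, images under \<open>matV\<close>, and the shear after
  \<open>matV\<close> is the rotation.\<close>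

lemma quadrants_shear:
  assumes "quadrants q x y"
  shows "quadrants q (x + y * lam q) y"
  using assms unfolding quadrants_def[of _ x y]
proof (elim disjE)
  assume "farey q (- x) (- y)"
  from farey_shear_fst[OF this] quadrants_minus[of "x + y * lam q" y]
  show ?thesis by (simp add: quadrants_def)
next
  assume "farey q y (- x)"
  from quadrants_farey_rotate[OF this] show ?thesis by (simp add: add.commute)
next
  assume "farey q (- y) x"
  from quadrants_farey_rotate[OF this] have "quadrants q (- y * lam q - x) (- y)" .
  moreover have "- y * lam q - x = - (x + y * lam q)" by simp
  ultimately have "quadrants q (- (x + y * lam q)) (- y)" by metis
  then show ?thesis by (simp only: quadrants_minus)
qed (use farey_shear_fst in \<open>auto simp: quadrants_def\<close>)

text \<open>The roles are exchanged: on the images under \<open>matV\<close> the inverse shear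
  amounts to the step with \<open>j = q - 2\<close> followed by \<open>matV\<close>.\<close>

lemma quadrants_unshear:
  assumes "quadrants q x y"
  shows "quadrants q (x - y * lam q) y"
  using assms unfolding quadrants_def[of _ x y]
proof (elim disjE)
  assume "farey q (- x) (- y)"
  from quadrants_farey_unshear[OF this] quadrants_minus[of "x - y * lam q" y]
  show ?thesis by simp
next
  assume "farey q y (- x)"
  from farey_shear_snd[OF this] show ?thesis by (simp add: quadrants_def)
next
  assume "farey q (- y) x"
  from farey_shear_snd[OF this] show ?thesis by (simp add: quadrants_def algebra_simps)
qed (use quadrants_farey_unshear in auto)

section \<open>The action of the matrix group\<close>

lemma vector_2_eq: "vector [x $ 1, x $ 2] = (x :: real^2)"
  by (simp add: vec_eq_iff forall_2)

lemma matV_mult: "matV *v vector [x, y] = vector [- y, x]"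
  by (simp add: vec_eq_iff forall_2 matrix_vector_mult_def sum_2 matV_def)

lemma matA1_mult: "matA1 q *v vector [x, y] = vector [x + y * lam q, y]"
  by (simp add: vec_eq_iff forall_2 matrix_vector_mult_def sum_2 matA1_def)

lemma Gmat_mult: "g \<in> Gmat q \<Longrightarrow> h \<in> Gmat q \<Longrightarrow> g ** h \<in> Gmat q"
  using generate.eng[of g SL2R _ h] by (simp add: Gmat_def SL2R_def)

lemma Gmat_det: "g \<in> Gmat q \<Longrightarrow> det g = 1"
  using group.generate_in_carrier[OF group_SL2R generators_in_SL2R]
  by (auto simp: Gmat_def SL2R_def)

lemma SL2R_inv:
  assumes "g \<in> carrier SL2R"
  shows "inv\<^bsub>SL2R\<^esub> g ** g = mat 1" "g ** inv\<^bsub>SL2R\<^esub> g = mat 1"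
  using group.l_inv[OF group_SL2R assms] group.r_inv[OF group_SL2R assms] by (simp_all add: SL2R_def)

lemma Gmat_inverse:
  assumes "g \<in> Gmat q"
  obtains h where "h \<in> Gmat q" "h ** g = mat 1" "g ** h = mat 1"
proof
  show "inv\<^bsub>SL2R\<^esub> g \<in> Gmat q"
    using group.generate_m_inv_closed[OF group_SL2R generators_in_SL2R] assms
    by (simp add: Gmat_def)
qed (use assms SL2R_inv group.generate_in_carrier[OF group_SL2R generators_in_SL2R]
      in \<open>auto simp: Gmat_def\<close>)

lemma quadrants_Gmat:
  assumes "g \<in> Gmat q" "quadrants q (x $ 1) (x $ 2)"
  shows "quadrants q ((g *v x) $ 1) ((g *v x) $ 2)"
  using assms(1)[unfolded Gmat_def] assms(2)
proof (induction arbitrary: x)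
  case one
  then show ?case by (simp add: SL2R_def)
next
  case (incl h)
  then show ?case
    using matV_mult[of "x $ 1" "x $ 2"] matA1_mult[of "x $ 1" "x $ 2"]
    by (auto simp: vector_2_eq quadrants_V quadrants_shear)
next
  case (inv h)
  \<comment> \<open>For an inverse generator a preimage of \<open>x\<close> inside the four
    quadrants suffices, so the inverse in the group is never computed.\<close>
  have "\<exists>y. h *v y = x \<and> quadrants q (y $ 1) (y $ 2)"
  proof (cases "h = matV")
    case True
    then show ?thesis
      using inv.prems quadrants_V[of "- (x $ 1)" "x $ 2"] quadrants_minus[of "x $ 1" "x $ 2"]
      by (intro exI[of _ "vector [x $ 2, - (x $ 1)]"]) (simp add: matV_mult vector_2_eq)
  next
    case False
    then show ?thesis
      using inv quadrants_unshear
      by (intro exI[of _ "vector [x $ 1 - x $ 2 * lam q, x $ 2]"])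
        (auto simp: matA1_mult vector_2_eq)
  qed
  then obtain y where y: "h *v y = x" "quadrants q (y $ 1) (y $ 2)" by blast
  have "inv\<^bsub>SL2R\<^esub> h *v x = (inv\<^bsub>SL2R\<^esub> h ** h) *v y"
    by (simp add: y(1) flip: matrix_vector_mul_assoc)
  also have "\<dots> = y"
    using inv.hyps generators_in_SL2R by (subst SL2R_inv) auto
  finally show ?case using y(2) by simp
next
  case (eng h1 h2)
  then show ?case by (simp add: SL2R_def flip: matrix_vector_mul_assoc)
qed

section \<open>Rotations and unit roots in the orbit\<close>

lemma Delta1E:
  assumes "z \<in> Delta1 q"
  obtains g where "g \<in> Gmat q" "z = psi q (g *v vector [1, 0])"
  using assms by (auto simp: Delta1_def)

lemma Delta1I: "g \<in> Gmat q \<Longrightarrow> psi q (g *v vector [1, 0]) \<in> Delta1 q"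
  by (auto simp: Delta1_def)

lemma Delta1_generator:
  assumes "z \<in> Delta1 q" "h \<in> {matV, matA1 q}"
  obtains x where "z = psi q x" "psi q (h *v x) \<in> Delta1 q"
proof -
  from assms(1) obtain g where g: "g \<in> Gmat q" "z = psi q (g *v vector [1, 0])"
    by (rule Delta1E)
  have "h \<in> Gmat q" using assms(2) by (simp add: Gmat_def generate.incl)
  then have "psi q ((h ** g) *v vector [1, 0]) \<in> Delta1 q" by (intro Delta1I Gmat_mult g)
  with g that[of "g *v vector [1, 0]"] show ?thesis by (simp add: matrix_vector_mul_assoc)
qed

lemma one_in_Delta1: "1 \<in> Delta1 q"
proof -
  have "mat 1 \<in> Gmat q" using generate.one[of SL2R] by (simp add: Gmat_def SL2R_def)
  from Delta1I[OF this] show ?thesis by (simp add: psi_vector)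
qed

lemma Im_psi: "Im (psi q x) = sin (pi / real q) * x $ 2"
  by (simp add: psi_def zeta_power_pred) (simp add: zeta_eq_cis)

text \<open>By \<open>Im_psi\<close> the second coordinate of \<open>z\<close> is
  \<open>Im z / sin (pi / real q)\<close>, so this is the action of \<open>matA1 q\<close> without
  reference to coordinates.\<close>

lemma shear_Delta1:
  assumes "z \<in> Delta1 q"
  shows "z + of_real (lam q * Im z / sin (pi / real q)) \<in> Delta1 q"
proof -
  from assms obtain x where x: "z = psi q x" "psi q (matA1 q *v x) \<in> Delta1 q"
    by (rule Delta1_generator[where h = "matA1 q"]) simp_all
  moreover have "psi q (matA1 q *v x) = psi q x + of_real (lam q * x $ 2)"
    using matA1_mult[of "x $ 1" "x $ 2"] by (simp add: vector_2_eq psi_def)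
  ultimately show ?thesis using sin_pos by (simp add: Im_psi)
qed

text \<open>Applying \<open>matV\<close> and then the shear multiplies by \<zeta>. After
  \<open>matV\<close> the second coordinate is \<open>x $ 1\<close>, which fixes the length of the
  shear.\<close>

lemma zeta_mult_Delta1:
  assumes "z \<in> Delta1 q"
  shows "zeta q * z \<in> Delta1 q"
proof -
  from assms obtain x where x: "z = psi q x" "psi q (matV *v x) \<in> Delta1 q"
    by (rule Delta1_generator[where h = matV]) simp_all
  have V: "psi q (matV *v x) = - of_real (x $ 2) + (zeta q - of_real (lam q)) * of_real (x $ 1)"
    using matV_mult[of "x $ 1" "x $ 2"] by (simp add: vector_2_eq psi_def zeta_power_pred)
  have "Im (psi q (matV *v x)) / sin (pi / real q) = x $ 1"
    using sin_pos matV_mult[of "x $ 1" "x $ 2"] by (simp add: vector_2_eq Im_psi)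
  then have "psi q (matV *v x) + of_real (lam q * x $ 1) \<in> Delta1 q"
    using shear_Delta1[OF x(2)] by (simp add: mult.assoc flip: times_divide_eq_right)
  also have "psi q (matV *v x) + of_real (lam q * x $ 1) =
      zeta q * of_real (x $ 1) + (zeta q * zeta q - of_real (lam q) * zeta q) * of_real (x $ 2)"
    by (simp add: V zeta_sq algebra_simps)
  also have "\<dots> = zeta q * z"
    by (simp add: x(1) psi_def zeta_power_pred algebra_simps)
  finally show ?thesis .
qed

lemma zeta_power_mult_Delta1: "z \<in> Delta1 q \<Longrightarrow> zeta q ^ k * z \<in> Delta1 q"
  by (induction k) (auto simp: mult.assoc intro: zeta_mult_Delta1)

lemma Delta1_rotate: "(*) (zeta q) ` Delta1 q = Delta1 q"
proof (intro equalityI subsetI)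
  fix z assume "z \<in> Delta1 q"
  then have "zeta q ^ (2 * q - 1) * z \<in> Delta1 q" by (rule zeta_power_mult_Delta1)
  moreover have "zeta q * (zeta q ^ (2 * q - 1) * z) = z"
    using q zeta_power_2q by (simp flip: mult.assoc power_Suc)
  ultimately show "z \<in> (*) (zeta q) ` Delta1 q" by (metis imageI)
qed (auto intro: zeta_mult_Delta1)

lemma UR_eq: "UR q = range (\<lambda>k. zeta q ^ k)"
proof -
  have "zeta q ^ k \<in> UR q" for k
  proof -
    have "zeta q ^ k = zeta q ^ (2 * q * (k div (2 * q)) + k mod (2 * q))" by simp
    also have "\<dots> = zeta q ^ (k mod (2 * q))"
      by (simp only: power_add power_mult[of _ "2 * q"] zeta_power_2q power_one mult_1)
    finally have *: "zeta q ^ k = zeta q ^ (k mod (2 * q))" .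
    have "k mod (2 * q) < 2 * q" using q by (intro mod_less_divisor) simp
    then have "k mod (2 * q) \<in> {0..2 * q - 1}" by simp
    with * show ?thesis unfolding UR_def by blast
  qed
  then show ?thesis by (auto simp: UR_def)
qed

lemma zeta_power_in_UR: "zeta q ^ k \<in> UR q"
  by (simp add: UR_eq)

lemma UR_subset_Delta1: "UR q \<subseteq> Delta1 q"
  using zeta_power_mult_Delta1[OF one_in_Delta1] by (auto simp: UR_eq)

lemma lam_plus_zeta_in_Delta1: "of_real (lam q) + zeta q \<in> Delta1 q"
proof -
  have "zeta q \<in> Delta1 q" using zeta_mult_Delta1[OF one_in_Delta1] by simp
  from shear_Delta1[OF this] sin_pos show ?thesis by (simp add: zeta_eq_cis add.commute)
qed

text \<open>This is the shear of \<open>\<zeta> ^ (q - 2)\<close>, whose coordinates are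
  \<open>1\<close> and \<open>lam q\<close>, just as \<open>lam q + \<zeta>\<close> is the shear of
  \<zeta>.\<close>

lemma one_plus_lam_zeta_in_Delta1: "1 + of_real (lam q) * zeta q \<in> Delta1 q"
proof -
  have "Suc (q - 2) = q - Suc 0" using q by simp
  then have eq: "zeta q ^ (q - 2) = 1 + (zeta q - of_real (lam q)) * of_real (lam q)"
    using zeta_power_diag[of "q - 2"] by (simp add: diag_q zeta_power_pred)
  have "zeta q ^ (q - 2) \<in> Delta1 q" using UR_subset_Delta1 zeta_power_in_UR by blast
  from shear_Delta1[OF this] sin_pos show ?thesis
    by (simp add: eq) (simp add: zeta_eq_cis algebra_simps)
qed

section \<open>Infinitude and discreteness\<close>

lemma infinite_Delta1: "infinite (Delta1 q)"
proof -
  have "zeta q + of_real (real n * lam q) \<in> Delta1 q" for n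
  proof (induction n)
    case 0
    then show ?case using zeta_mult_Delta1[OF one_in_Delta1] by simp
  next
    case (Suc n)
    from shear_Delta1[OF this] sin_pos show ?case by (simp add: zeta_eq_cis algebra_simps)
  qed
  then have "range (\<lambda>n. zeta q + of_real (real n * lam q)) \<subseteq> Delta1 q" by auto
  moreover have "inj (\<lambda>n. zeta q + of_real (real n * lam q))"
  proof (rule injI)
    fix m n assume "zeta q + of_real (real m * lam q) = zeta q + of_real (real n * lam q)"
    then have "real m * lam q = real n * lam q" by (metis add_left_cancel of_real_eq_iff)
    then show "m = n" using lam_ge_1 by simp
  qed
  ultimately show ?thesis using finite_subset range_inj_infinite by blast
qed

lemma quadrants_Delta1:
  assumes "g \<in> Gmat q"
  shows "quadrants q ((g *v vector [1, 0]) $ 1) ((g *v vector [1, 0]) $ 2)"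
  using quadrants_Gmat[OF assms, of "vector [1, 0]"] farey.fst by (simp add: quadrants_def)

lemma quadrants_snd:
  assumes "quadrants q x y"
  shows "(y = 0 \<and> \<bar>x\<bar> = 1) \<or> 1 \<le> \<bar>y\<bar>"
  using assms by (auto simp: quadrants_def dest!: farey_coords)

text \<open>Let \<open>z\<close> and \<open>w\<close> come from the images under \<open>g\<close> of
  the first unit vector and of \<open>f\<close>. Then \<open>Im (cnj z * w)\<close> is
  \<open>sin (pi / real q)\<close> times their determinant, which is \<open>f $ 2\<close> because
  \<open>det g = 1\<close>. This is \<open>0\<close> only for \<open>w = z\<close> or
  \<open>w = - z\<close>, and otherwise at least \<open>1\<close> in absolute value. Replacing
  \<open>w\<close> by \<open>w - z\<close> does not change the imaginary part.\<close>

lemma Delta1_separated: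
  assumes "z \<in> Delta1 q" "w \<in> Delta1 q" "w \<noteq> z" "w \<noteq> - z"
  shows "sin (pi / real q) \<le> cmod z * cmod (w - z)"
proof -
  obtain g h where g: "g \<in> Gmat q" "z = psi q (g *v vector [1, 0])"
    and h: "h \<in> Gmat q" "w = psi q (h *v vector [1, 0])"
    using assms by (metis Delta1E)
  obtain g' where g': "g' \<in> Gmat q" "g ** g' = mat 1" using Gmat_inverse[OF g(1)] by metis
  define f where "f = (g' ** h) *v vector [1, 0]"
  have gf: "g *v f = h *v vector [1, 0]"
    by (simp add: f_def matrix_vector_mul_assoc matrix_mul_assoc g')
  have quad: "quadrants q (f $ 1) (f $ 2)"
    unfolding f_def by (intro quadrants_Delta1 Gmat_mult g' h)
  have coords: "(g *v f) $ i = g $ i $ 1 * f $ 1 + g $ i $ 2 * f $ 2"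
    "(g *v vector [1, 0]) $ i = g $ i $ 1" for i
    by (simp_all add: matrix_vector_mult_def sum_2)
  have "f $ 2 \<noteq> 0"
  proof
    assume "f $ 2 = 0"
    moreover from this have "f $ 1 = 1 \<or> f $ 1 = - 1" using quadrants_snd[OF quad] by auto
    ultimately have "w = z \<or> w = - z"
      by (auto simp: g h coords psi_def simp flip: gf)
    with assms show False by simp
  qed
  with quadrants_snd[OF quad] have f2: "1 \<le> \<bar>f $ 2\<bar>" by auto
  have Im_psi_psi: "Im (cnj (psi q x) * psi q y) = sin (pi / real q) * (x $ 1 * y $ 2 - x $ 2 * y $ 1)" for x y
    by (simp add: psi_def zeta_power_pred) (simp add: zeta_eq_cis algebra_simps)
  have "Im (cnj z * w) = sin (pi / real q) * (det g * f $ 2)"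
    unfolding g h gf[symmetric] Im_psi_psi det_2 coords by (simp add: algebra_simps)
  then have "Im (cnj z * w) = sin (pi / real q) * f $ 2" by (simp add: Gmat_det[OF g(1)])
  moreover have "Im (cnj z * w) = Im (cnj z * (w - z))" by (simp add: algebra_simps)
  ultimately have "\<bar>sin (pi / real q) * f $ 2\<bar> = \<bar>Im (cnj z * (w - z))\<bar>"
    by (simp only:)
  also have "\<dots> \<le> cmod z * cmod (w - z)"
    using abs_Im_le_cmod[of "cnj z * (w - z)"] by (simp add: norm_mult)
  finally have "sin (pi / real q) * \<bar>f $ 2\<bar> \<le> cmod z * cmod (w - z)"
    using sin_pos by (simp add: abs_mult)
  moreover have "sin (pi / real q) * 1 \<le> sin (pi / real q) * \<bar>f $ 2\<bar>"
    using f2 sin_pos by (intro mult_left_mono) auto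
  ultimately show ?thesis by linarith
qed

lemma zero_notin_Delta1: "0 \<notin> Delta1 q"
proof
  assume "0 \<in> Delta1 q"
  with Delta1_separated[OF this one_in_Delta1] sin_pos show False by simp
qed

lemma discrete_Delta1: "discrete (Delta1 q)"
  unfolding discrete_def isolated_in_dist_Ex_iff
proof (intro ballI conjI)
  fix z assume z: "z \<in> Delta1 q"
  with zero_notin_Delta1 have "z \<noteq> 0" by auto
  \<comment> \<open>The first bound excludes \<open>- z\<close>, at distance
    \<open>2 * cmod z\<close>; the second excludes all other points by
    \<open>Delta1_separated\<close>.\<close>
  define e where "e = min (cmod z) (sin (pi / real q) / cmod z)"
  have "w = z" if w: "w \<in> Delta1 q" "dist z w < e" for w
  proof (rule ccontr)
    assume "w \<noteq> z"
    show False
    proof (cases "w = - z")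
      case True
      then have "dist z w = 2 * cmod z" by (simp add: dist_norm flip: mult_2)
      with w \<open>z \<noteq> 0\<close> show False by (simp add: e_def)
    next
      case False
      with Delta1_separated[OF z w(1) \<open>w \<noteq> z\<close>] have "sin (pi / real q) / cmod z \<le> dist z w"
        using \<open>z \<noteq> 0\<close> by (simp add: dist_norm norm_minus_commute field_simps)
      with w show False by (simp add: e_def)
    qed
  qed
  moreover have "0 < e" using \<open>z \<noteq> 0\<close> sin_pos by (simp add: e_def)
  ultimately show "\<exists>e>0. \<forall>w\<in>Delta1 q. dist z w < e \<longrightarrow> w = z" by blast
qed

section \<open>Short vectors of the orbit\<close>

lemma psi_farey:
  assumes "farey q a b"
  obtains k c d where "farey q c d" "psi q (vector [a, b]) = zeta q ^ k * (of_real c + of_real d * zeta q)"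
  using assms
proof cases
  case fst
  then show ?thesis using that[of 1 0 0] farey.fst by (simp add: psi_vector)
next
  case snd
  then show ?thesis using that[of 1 0 "q - 1"] farey.fst by (simp add: psi_vector)
next
  case (step c d j)
  have "psi q (vector [a, b]) = of_real c * zeta q ^ j + of_real d * zeta q ^ Suc j"
    unfolding zeta_power_diag[of j] zeta_power_diag[of "Suc j"]
    by (simp add: psi_vector step algebra_simps)
  also have "\<dots> = zeta q ^ j * (of_real c + of_real d * zeta q)"
    by (simp add: algebra_simps)
  finally show ?thesis using that step by blast
qed

text \<open>On the first quadrant \<open>psi_farey\<close> undoes the last step. An image under
  \<open>matV\<close> has this form without that, since \<open>- d + c * \<zeta> ^ (q - 1)\<close>
  is \<open>\<zeta> ^ (q - 1) * (c + d * \<zeta>)\<close>; a sign is absorbed by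
  \<open>\<zeta> ^ q = - 1\<close>.\<close>

lemma Delta1_sector:
  assumes "z \<in> Delta1 q"
  obtains k a b where "farey q a b" "z = zeta q ^ k * (of_real a + of_real b * zeta q)"
proof -
  from assms obtain g where "g \<in> Gmat q" "z = psi q (g *v vector [1, 0])" by (rule Delta1E)
  then obtain x y where xy: "quadrants q x y" "z = psi q (vector [x, y])"
    using quadrants_Delta1 vector_2_eq by metis
  have minus: "psi q (vector [- c, - d]) = zeta q ^ q * psi q (vector [c, d])" for c d
    by (simp add: psi_vector zeta_power_q)
  have V: "psi q (vector [- d, c]) = zeta q ^ (q - 1) * (of_real c + of_real d * zeta q)" for c d
  proof -
    have "zeta q ^ (q - 1) * zeta q = - 1"
      using q zeta_power_q by (simp flip: power_Suc2)
    then show ?thesis by (simp add: psi_vector ring_distribs) (simp add: mult.left_commute)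
  qed
  have V': "psi q (vector [d, - c]) = zeta q ^ (q + (q - 1)) * (of_real c + of_real d * zeta q)" for c d
    using minus[of "- d" c] V[of d c] by (simp add: power_add)
  from xy(1) show ?thesis unfolding quadrants_def
  proof (elim disjE)
    assume "farey q x y"
    then show ?thesis using psi_farey xy(2) that by metis
  next
    assume "farey q (- x) (- y)"
    then obtain k c d where "farey q c d"
      "psi q (vector [- x, - y]) = zeta q ^ k * (of_real c + of_real d * zeta q)"
      by (rule psi_farey)
    then show ?thesis using that[of c d "q + k"] xy(2) minus[of "- x" "- y"]
      by (simp add: power_add)
  next
    assume "farey q y (- x)"
    then show ?thesis using that[of y "- x" "q - 1"] xy(2) V[of "- x" y] by simp
  next
    assume "farey q (- y) x"
    then show ?thesis using that[of "- y" x "q + (q - 1)"] xy(2) V'[of x "- y"] by simp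
  qed
qed

text \<open>Law of cosines for an acute angle: the mixed term is positive, so the norm grows with
  nonnegative coordinates. With \<open>\<zeta> ^ (q - 1)\<close> in place of \<zeta> it would be
  negative, which is why \<open>psi_farey\<close> changes the sector.\<close>

lemma cmod_add_zeta_sq:
  "(cmod (of_real a + of_real b * zeta q))\<^sup>2 = a\<^sup>2 + b\<^sup>2 + lam q * a * b"
proof -
  have "(cmod (of_real a + of_real b * zeta q))\<^sup>2
      = a\<^sup>2 + b\<^sup>2 * ((cos (pi / real q))\<^sup>2 + (sin (pi / real q))\<^sup>2) + lam q * a * b"
    by (simp add: cmod_power2 zeta_eq_cis lam_def power_mult_distrib power2_sum algebra_simps
        del: sin_cos_squared_add sin_cos_squared_add2)
  then show ?thesis by simp
qed

text \<open>Consecutive diagonals with \<open>j\<close> among \<open>0\<close>, \<open>1\<close>,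
  \<open>q - 2\<close>, \<open>q - 1\<close> give the listed numbers. All other norms are compared
  with that of \<open>(lam q + 1, 1)\<close>, its mirror image or
  \<open>(lam q, lam q)\<close>.\<close>

lemma farey_large:
  assumes "farey q a b"
  shows "of_real a + of_real b * zeta q \<in> UR q * {1, of_real (lam q) + zeta q, 1 + of_real (lam q) * zeta q}
    \<or> 2 * (lam q)\<^sup>2 + 1 < a\<^sup>2 + b\<^sup>2 + lam q * a * b" (is "?z a b \<in> ?S \<or> ?L < ?N a b")
proof -
  have S: "zeta q ^ k * s \<in> ?S" if "s \<in> {1, of_real (lam q) + zeta q, 1 + of_real (lam q) * zeta q}" for k s
    using that zeta_power_in_UR by (intro set_times_intro)
  have l: "1 \<le> lam q" by (rule lam_ge_1)
  have mono: "?N a' b' \<le> ?N a b" if "0 \<le> a'" "a' \<le> a" "0 \<le> b'" "b' \<le> b" for a b a' b'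
    using that l by (intro add_mono power_mono mult_mono) auto
  have large: "?L < (lam q + 1)\<^sup>2 + 1\<^sup>2 + lam q * (lam q + 1) * 1"
    using l by (simp add: power2_eq_square algebra_simps)
  from farey_cases[OF assms] show ?thesis
  proof (elim disjE exE conjE)
    assume "lam q + 1 \<le> a" "1 \<le> b"
    with mono[of "lam q + 1" a 1 b] large l show ?thesis by simp
  next
    assume "1 \<le> a" "lam q + 1 \<le> b"
    with mono[of 1 a "lam q + 1" b] large l show ?thesis by (simp add: algebra_simps)
  next
    fix j assume j: "j < q" "a = diag q (Suc j)" "b = diag q j"
    consider "j = 0" | "j = 1" | "j = q - 1" | "j = q - 2" | "2 \<le> j" "j + 3 \<le> q" using j by linarith
    then show ?thesis
    proof cases
      case 1
      then show ?thesis using j S[of 1 0] by simp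
    next
      case 2
      then show ?thesis using j S[of "of_real (lam q) + zeta q" 0] by simp
    next
      case 3
      then show ?thesis using j q S[of 1 1] by (simp add: diag_q)
    next
      case 4
      then have "a = 1" "b = lam q" using j q diag_q by (simp_all add: Suc_diff_Suc numeral_2_eq_2)
      then show ?thesis using S[of "1 + of_real (lam q) * zeta q" 0] by simp
    next
      case 5
      \<comment> \<open>The range of \<open>j\<close> forces \<open>5 \<le> q\<close>; the strict
        inequality then comes from \<open>1 < lam q ^ 3\<close>.\<close>
      have "1 < lam q" using 5 by (intro lam_gt_1) simp
      have "lam q \<le> a" "lam q \<le> b" using 5 j by (auto intro!: diag_ge_lam)
      with mono[of "lam q" a "lam q" b] l have "?N (lam q) (lam q) \<le> ?N a b" by simp
      moreover have "1 < lam q * lam q * lam q"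
        using \<open>1 < lam q\<close> by (intro less_1_mult)
      ultimately show ?thesis by (simp add: power2_eq_square)
    qed
  qed
qed

lemma cmod_lam_plus_zeta: "cmod (of_real (lam q) + zeta q) = sqrt (2 * (lam q)\<^sup>2 + 1)"
  using cmod_add_zeta_sq[of "lam q" 1]
  by (intro real_sqrt_unique [symmetric]) (simp_all add: power2_eq_square)

lemma cmod_one_plus_lam_zeta: "cmod (1 + of_real (lam q) * zeta q) = sqrt (2 * (lam q)\<^sup>2 + 1)"
  using cmod_add_zeta_sq[of 1 "lam q"]
  by (intro real_sqrt_unique [symmetric]) (simp_all add: power2_eq_square)

lemma Delta1_large:
  assumes "z \<in> Delta1 q"
    and "z \<notin> UR q * {1, of_real (lam q) + zeta q, 1 + of_real (lam q) * zeta q}"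
  shows "cmod (of_real (lam q) + zeta q) < cmod z"
proof -
  from assms(1) obtain k a b
    where ab: "farey q a b" and z: "z = zeta q ^ k * (of_real a + of_real b * zeta q)"
    by (rule Delta1_sector)
  have "of_real a + of_real b * zeta q \<notin> UR q * {1, of_real (lam q) + zeta q, 1 + of_real (lam q) * zeta q}"
  proof
    assume "of_real a + of_real b * zeta q \<in> UR q * {1, of_real (lam q) + zeta q, 1 + of_real (lam q) * zeta q}"
    then obtain w s where ws: "w \<in> UR q" "s \<in> {1, of_real (lam q) + zeta q, 1 + of_real (lam q) * zeta q}"
      "of_real a + of_real b * zeta q = w * s" by (rule set_times_elim)
    from ws(1) obtain i where "w = zeta q ^ i" by (auto simp: UR_eq)
    then have "z = zeta q ^ (k + i) * s" by (simp add: z ws(3) power_add)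
    with ws(2) zeta_power_in_UR assms(2) show False by (metis set_times_intro)
  qed
  with farey_large[OF ab] have "2 * (lam q)\<^sup>2 + 1 < (cmod (of_real a + of_real b * zeta q))\<^sup>2"
    by (simp add: cmod_add_zeta_sq)
  then have "sqrt (2 * (lam q)\<^sup>2 + 1) < cmod (of_real a + of_real b * zeta q)"
    by (intro real_less_lsqrt) auto
  moreover have "cmod z = cmod (of_real a + of_real b * zeta q)"
    by (simp add: z norm_mult norm_power zeta_eq_cis)
  ultimately show ?thesis by (simp add: cmod_lam_plus_zeta)
qed

section \<open>Counting the \<open>4 * q\<close> elements\<close>

lemma card_UR: "card (UR q) = 2 * q" "finite (UR q)"
proof -
  let ?f = "\<lambda>k. cis (2 * pi * real k / real (2 * q))"
  have "{0..2 * q - 1} = {..<2 * q}" using q by auto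
  then have UR: "UR q = ?f ` {..<2 * q}"
    by (auto simp: UR_def zeta_power image_def mult.commute)
  have "bij_betw ?f {..<2 * q} {z. z ^ (2 * q) = 1}"
    using q by (intro Complex.bij_betw_roots_unity) simp
  then have "inj_on ?f {..<2 * q}" by (rule bij_betw_imp_inj_on)
  then show "card (UR q) = 2 * q" unfolding UR by (subst card_image) simp_all
  show "finite (UR q)" unfolding UR by (rule finite_imageI) simp
qed

text \<open>The quotient of the two numbers lies strictly between the directions \<open>1\<close> and \<open>\<zeta>\<close>.\<close>

lemma zeta_power_mult_lam_plus_zeta_neq:
  assumes "4 \<le> q"
  shows "zeta q ^ m * (of_real (lam q) + zeta q) \<noteq> 1 + of_real (lam q) * zeta q"
proof
  let ?u = "of_real (lam q) + zeta q" and ?v = "1 + of_real (lam q) * zeta q"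
  assume eq: "zeta q ^ m * ?u = ?v"
  have l: "1 < lam q" using assms by (rule lam_gt_1)
  have z: "cnj (zeta q) = of_real (lam q) - zeta q" by (simp add: of_real_lam)
  have "zeta q ^ m \<in> UR q" by (rule zeta_power_in_UR)
  then obtain k where k: "zeta q ^ m = zeta q ^ k" "k < 2 * q" using q by (auto simp: UR_def)
  \<comment> \<open>Up to the positive factor \<open>r\<close>, the assumed quotient
    \<open>\<zeta> ^ k\<close> is \<open>?v * cnj ?u\<close>, so signs of imaginary parts can be
    read off.\<close>
  define r where "r = (cmod ?u)\<^sup>2"
  have "0 < r" by (simp add: r_def cmod_lam_plus_zeta add_nonneg_pos)
  have w: "zeta q ^ k * of_real r = ?v * cnj ?u"
    unfolding r_def complex_norm_square k(1)[symmetric] eq[symmetric] by (simp only: mult.assoc)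
  have "r * Im (zeta q ^ k) = Im (?v * cnj ?u)" unfolding w[symmetric] by simp
  also have "\<dots> = ((lam q)\<^sup>2 - 1) * sin (pi / real q)"
    by (simp add: zeta_eq_cis power2_eq_square algebra_simps)
  also have "\<dots> > 0" using l sin_pos by (simp add: power2_eq_square less_1_mult)
  finally have pos: "0 < Im (zeta q ^ k)" using \<open>0 < r\<close> by (simp add: zero_less_mult_iff)
  have "r * Im (cnj (zeta q) * zeta q ^ k) = Im (cnj (zeta q) * (?v * cnj ?u))"
    unfolding w[symmetric] mult.assoc[symmetric] by simp
  also have "cnj (zeta q) * (?v * cnj ?u) = (cnj (zeta q) + of_real (lam q)) * (of_real (lam q) + cnj (zeta q))"
  proof -
    have "cnj (zeta q) * ?v = cnj (zeta q) + of_real (lam q)"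
      by (simp add: ring_distribs) (simp add: zeta_eq_cis cis_cnj cis_mult)
    then show ?thesis by (simp flip: mult.assoc)
  qed
  also have "Im \<dots> = - (3 * lam q * sin (pi / real q))"
    by (simp add: zeta_eq_cis lam_def algebra_simps)
  also have "\<dots> < 0" using l sin_pos by simp
  finally have neg: "Im (cnj (zeta q) * zeta q ^ k) < 0" using \<open>0 < r\<close> by (simp add: mult_less_0_iff)
  \<comment> \<open>The sign in \<open>pos\<close> forces \<open>0 < k < q\<close>; then
    \<open>\<zeta> ^ (k - 1)\<close> lies in the closed upper half plane, contrary to
    \<open>neg\<close>.\<close>
  have "k < q"
  proof (rule ccontr)
    assume "\<not> k < q"
    then have "zeta q ^ k = - (zeta q ^ (k - q))"
      using zeta_power_q power_add[of "zeta q" q "k - q"] by simp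
    moreover have "0 \<le> Im (zeta q ^ (k - q))"
      unfolding zeta_power using k q by (auto intro!: sin_ge_zero simp: field_simps of_nat_diff)
    ultimately show False using pos by simp
  qed
  moreover from pos obtain i where i: "k = Suc i" by (cases k) auto
  moreover have "cnj (zeta q) * zeta q ^ Suc i = zeta q ^ i"
    by (simp add: zeta_eq_cis cis_cnj cis_mult flip: mult.assoc)
  moreover from \<open>k < q\<close> i have "0 \<le> Im (zeta q ^ i)"
    unfolding zeta_power using q by (auto intro!: sin_ge_zero simp: field_simps)
  ultimately show False using neg by (metis not_less)
qed

text \<open>The set is the disjoint union of two rotation orbits of size \<open>2 * q\<close>. For
  \<open>q = 3\<close> they coincide because \<open>lam 3 = 1\<close>, whence the
  assumption.\<close>

lemma card_minimal_vectors:
  assumes "4 \<le> q"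
  shows "card (UR q * {of_real (lam q) + zeta q, 1 + of_real (lam q) * zeta q}) = 4 * q"
proof -
  let ?u = "of_real (lam q) + zeta q" and ?v = "1 + of_real (lam q) * zeta q"
  have "0 < 2 * (lam q)\<^sup>2 + 1" by (intro add_nonneg_pos) auto
  then have "0 < cmod ?u" "0 < cmod ?v"
    by (simp_all only: cmod_lam_plus_zeta cmod_one_plus_lam_zeta real_sqrt_gt_0_iff)
  then have "?u \<noteq> 0" "?v \<noteq> 0" by (metis zero_less_norm_iff)+
  have card: "card ((\<lambda>w. w * s) ` UR q) = 2 * q" if "s \<noteq> 0" for s
    using that by (simp add: card_image inj_on_def card_UR)
  have disj: "(\<lambda>w. w * ?u) ` UR q \<inter> (\<lambda>w. w * ?v) ` UR q = {}"
  proof (rule ccontr)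
    assume "(\<lambda>w. w * ?u) ` UR q \<inter> (\<lambda>w. w * ?v) ` UR q \<noteq> {}"
    then obtain i j where ij: "zeta q ^ i * ?u = zeta q ^ j * ?v" by (auto simp: UR_eq)
    \<comment> \<open>The exponent \<open>(2 * q - 1) * j\<close> yields the inverse of
      \<open>\<zeta> ^ j\<close> as a natural power.\<close>
    have "zeta q ^ (2 * q * j) = 1" by (simp only: power_mult[of _ "2 * q"] zeta_power_2q power_one)
    moreover have "2 * q * j = (2 * q - 1) * j + j" using q by (simp add: algebra_simps)
    ultimately have *: "zeta q ^ ((2 * q - 1) * j) * zeta q ^ j = 1" by (simp only: power_add)
    have "zeta q ^ ((2 * q - 1) * j + i) * ?u = zeta q ^ ((2 * q - 1) * j) * (zeta q ^ j * ?v)"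
      by (simp only: power_add mult.assoc ij)
    also have "\<dots> = ?v" using * by (simp only: mult.assoc [symmetric] mult_1)
    finally show False using zeta_power_mult_lam_plus_zeta_neq[OF assms] by blast
  qed
  have "UR q * {?u, ?v} = (\<lambda>w. w * ?u) ` UR q \<union> (\<lambda>w. w * ?v) ` UR q"
    by (auto simp: set_times_def)
  then show ?thesis
    using card_Un_disjoint[OF _ _ disj] card[OF \<open>?u \<noteq> 0\<close>] card[OF \<open>?v \<noteq> 0\<close>] by (simp add: card_UR)
qed

end

section \<open>Numerical values of the bound\<close>

lemma lam_5_sq: "(lam 5)\<^sup>2 = lam 5 + 1"
proof -
  let ?c = "cos (pi / 5)"
  \<comment> \<open>Comparing the triple with the double angle gives a cubic equation for
    \<open>?c\<close>; removing its factor \<open>?c + 1\<close> leaves the equation of the golden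
    ratio for \<open>lam 5\<close>.\<close>
  have "cos (3 * (pi / 5)) = cos (pi - 2 * (pi / 5))" by (rule arg_cong[of _ _ cos]) simp
  also have "\<dots> = - cos (2 * (pi / 5))" by (simp only: cos_pi_minus)
  finally have "4 * ?c ^ 3 - 3 * ?c = - (2 * ?c\<^sup>2 - 1)"
    by (simp only: cos_treble_cos cos_double_cos)
  then have "(?c + 1) * (4 * ?c\<^sup>2 - 2 * ?c - 1) = 0"
    by (simp add: algebra_simps power2_eq_square power3_eq_cube)
  moreover have "0 < ?c" by (intro cos_gt_zero) auto
  ultimately show ?thesis by (simp add: lam_def power_mult_distrib)
qed

text \<open>
  Here \<open>2 cos (2\<pi>/7) = lam 7 ^ 2 - 2\<close> is the only root greater than \<open>1\<close> of \<open>m^3 + m^2 - 2 m - 1\<close>; the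
  constant is rational and only slightly below \<open>lam 7 ^ 2 = 3.24697...\<close>.
\<close>

lemma lam_7_sq: "3.246953125 < (lam 7)\<^sup>2"
proof -
  let ?c = "cos (2 * (pi / 7))"
  define m where "m = 2 * ?c"
  \<comment> \<open>Three and four times \<open>2 * pi / 7\<close> add up to \<open>2 * pi\<close>,
    so their cosines agree. This yields the cubic with an extra factor \<open>m - 2\<close>.\<close>
  have "cos (3 * (2 * (pi / 7))) = cos (2 * pi - 2 * (2 * (2 * (pi / 7))))"
    by (rule arg_cong[of _ _ cos]) simp
  also have "\<dots> = cos (2 * (2 * (2 * (pi / 7))))" by (simp only: cos_2pi_minus)
  finally have "4 * ?c ^ 3 - 3 * ?c = 2 * (2 * ?c\<^sup>2 - 1)\<^sup>2 - 1"
    by (simp only: cos_treble_cos cos_double_cos[of "2 * (2 * (pi / 7))"] cos_double_cos[of "2 * (pi / 7)"])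
  then have "(m - 2) * (m * (m\<^sup>2 + m - 2) - 1) = 0"
    by (simp add: m_def algebra_simps power2_eq_square power3_eq_cube)
  moreover have "?c < cos 0" by (intro cos_monotone_0_pi) auto
  ultimately have root: "m * (m\<^sup>2 + m - 2) = 1" by (simp add: m_def)
  have "cos (pi / 3) < ?c" by (intro cos_monotone_0_pi) auto
  then have "1 < m" by (simp add: m_def cos_60)
  \<comment> \<open>The constant is \<open>(2.7375 ^ 2 - 1) / 2 - 2\<close>, exactly what the lower
    bound \<open>2.7375\<close> requires; there the cubic is still negative.\<close>
  have "1.246953125 < m"
  proof (rule ccontr)
    assume "\<not> 1.246953125 < m"
    then have le: "m \<le> 1.246953125" by simp
    have "1 * 1 \<le> m * m" using \<open>1 < m\<close> by (intro mult_mono) auto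
    then have "m * (m\<^sup>2 + m - 2) \<le> 1.246953125 * (1.246953125\<^sup>2 + 1.246953125 - 2)"
      using le \<open>1 < m\<close> by (intro mult_mono add_mono diff_mono power_mono) (auto simp: power2_eq_square)
    with root show False by (simp add: power2_eq_square)
  qed
  moreover have "(lam 7)\<^sup>2 = m + 2"
    using cos_double_cos[of "pi / 7"] by (simp add: m_def lam_def power_mult_distrib)
  ultimately show ?thesis by simp
qed

text \<open>\<open>lam q\<close> increases with \<open>q\<close> and stays below \<open>2\<close>,
  so the lower bound is decided at \<open>q = 7\<close>.\<close>

lemma sqrt_two_lam_sq_bounds:
  assumes "7 \<le> q"
  shows "sqrt (2 * (lam q)\<^sup>2 + 1) \<in> {2.7375<..<3}"
proof -
  have "cos (pi / 7) \<le> cos (pi / real q)"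
    using assms by (intro cos_monotone_0_pi_le) (auto simp: field_simps)
  moreover have "0 < cos (pi / 7)" by (intro cos_gt_zero) auto
  moreover have "cos (pi / real q) < cos 0"
    using assms by (intro cos_monotone_0_pi) (auto simp: field_simps)
  ultimately have "lam 7 \<le> lam q" "0 < lam 7" "lam q < 2" by (simp_all add: lam_def)
  then have "(lam 7)\<^sup>2 \<le> (lam q)\<^sup>2" "(lam q)\<^sup>2 < 2\<^sup>2"
    by (intro power_mono power_strict_mono; simp)+
  then have "2.7375\<^sup>2 < 2 * (lam q)\<^sup>2 + 1" "2 * (lam q)\<^sup>2 + 1 < 3\<^sup>2"
    using lam_7_sq by (simp_all add: power2_eq_square)
  then have "2.7375 < sqrt (2 * (lam q)\<^sup>2 + 1)" "sqrt (2 * (lam q)\<^sup>2 + 1) < 3"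
    by - (rule real_less_rsqrt, assumption, rule real_less_lsqrt, simp_all)
  then show ?thesis by simp
qed

theorem theorem1p1:
  fixes q :: nat and \<zeta> :: complex and l :: real
  assumes q: "q \<ge> 3"
  defines "\<zeta> \<equiv> zeta q" and "l \<equiv> lam q"
  shows
    "(infinite (Delta1 q) \<and> discrete (Delta1 q))
   \<and> (\<lambda>z. cis (2 * pi / (2 * real q)) * z) ` Delta1 q = Delta1 q
   \<and> (UR q \<subseteq> Delta1 q
      \<and> UR q * {of_real l + \<zeta>, 1 + of_real l * \<zeta>} \<subseteq> Delta1 q
      \<and> (q \<ge> 4 \<longrightarrow> card (UR q * {of_real l + \<zeta>, 1 + of_real l * \<zeta>}) = 4 * q))
   \<and> ((\<forall>z \<in> Delta1 q - UR q * {1, of_real l + \<zeta>, 1 + of_real l * \<zeta>}.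
          cmod z > cmod (of_real l + \<zeta>))
      \<and> cmod (of_real l + \<zeta>) = cmod (1 + of_real l * \<zeta>)
      \<and> cmod (1 + of_real l * \<zeta>) = sqrt (2 * l\<^sup>2 + 1)
      \<and> (q = 3 \<longrightarrow> sqrt (2 * l\<^sup>2 + 1) = sqrt 3)
      \<and> (q = 4 \<longrightarrow> sqrt (2 * l\<^sup>2 + 1) = sqrt 5)
      \<and> (q = 5 \<longrightarrow> sqrt (2 * l\<^sup>2 + 1) = sqrt (4 + sqrt 5))
      \<and> (q = 6 \<longrightarrow> sqrt (2 * l\<^sup>2 + 1) = sqrt 7)
      \<and> (q \<ge> 7 \<longrightarrow> sqrt (2 * l\<^sup>2 + 1) \<in> {2.7375<..<3}))"
proof -
  interpret hecke q by unfold_locales (rule q)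
  have "(\<lambda>z. cis (2 * pi / (2 * real q)) * z) ` Delta1 q = Delta1 q"
    using Delta1_rotate by (simp add: zeta_eq_cis)
  moreover have "UR q * {of_real l + \<zeta>, 1 + of_real l * \<zeta>} \<subseteq> Delta1 q"
    unfolding l_def \<zeta>_def
    using lam_plus_zeta_in_Delta1 one_plus_lam_zeta_in_Delta1
    by (auto simp: UR_eq elim!: set_times_elim intro: zeta_power_mult_Delta1)
  moreover have "2 * l\<^sup>2 + 1 = 3" if "q = 3"
    using that by (simp add: l_def lam_def cos_60)
  moreover have "2 * l\<^sup>2 + 1 = 5" if "q = 4"
    using that by (simp add: l_def lam_def cos_45)
  moreover have "2 * l\<^sup>2 + 1 = 4 + sqrt 5" if "q = 5"
  proof -
    have "(2 * lam 5 - 1)\<^sup>2 = 5" using lam_5_sq by (simp add: power2_eq_square algebra_simps)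
    then have "sqrt 5 = 2 * lam 5 - 1" using lam_ge_1 that by (intro real_sqrt_unique) auto
    then show ?thesis using that lam_5_sq by (simp add: l_def)
  qed
  moreover have "2 * l\<^sup>2 + 1 = 7" if "q = 6"
    using that by (simp add: l_def lam_def cos_30)
  ultimately show ?thesis
    using infinite_Delta1 discrete_Delta1 UR_subset_Delta1
      card_minimal_vectors Delta1_large cmod_lam_plus_zeta
      cmod_one_plus_lam_zeta sqrt_two_lam_sq_bounds[of q]
    unfolding l_def \<zeta>_def by auto
qed

end
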